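(* As an identity of formal power series in $q$ (equivalently, for $|q|<1$), $$\sum_{n=0}^{\infty}\overline{\sigma_o\mathrm{mex}}(n)\,q^n=\frac{1}{(q;q)_\infty}\sum_{j=0}^{\infty}(2j+1)\,4^j\,q^{j(2j+1)}\,(1-q^{2j+1})\,(-q^{2j+2};q)_\infty .$$
   Context: An overpartition of a nonnegative integer $n$ is a non-increasing sequence of positive integers summing to $n$ in which the first occurrence of each distinct integer may (or may not) be overlined; $\overline{\mathcal P}(n)$ denotes the set of all overpartitions of $n$ (the only overpartition of $0$ is the empty one). For an overpartition $\lambda$, $\mathrm{mex}(\lambda)$ is the least positive integer that does not occur as a part of $\lambda$, where a value counts as occurring whether it appears overlined or non-overlined. Put $\mathrm{mex}_o(\lambda)=\mathrm{mex}(\lambda)$ if $\mathrm{mex}(\lambda)$ is odd and $\mathrm{mex}_o(\lambda)=0$ otherwise. Define $\overline{\sigma_o\mathrm{mex}}(n)=\sum_{\lambda\in\overline{\mathcal P}(n)}\mathrm{mex}_o(\lambda)$ for $n\ge 0$. Notation: $(a;q)_\infty=\prod_{i=0}^{\infty}(1-aq^i)$. *)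

theory Defs
  imports "HOL-Analysis.Analysis" "HOL-Computational_Algebra.Formal_Power_Series"
begin

text \<open>
  An overpartition is the list of its parts in non-increasing order; the entry \<open>(k, b)\<close> is a part
  of value \<open>k\<close>, overlined iff \<open>b\<close> is true. Only the first occurrence of a value may be overlined.
\<close>

definition overpartitions :: "nat \<Rightarrow> (nat \<times> bool) list set" where
  "overpartitions n = {xs.
     sorted_wrt (\<ge>) (map fst xs) \<and>
     (\<forall>x\<in>set xs. fst x > 0) \<and>
     sum_list (map fst xs) = n \<and>
     (\<forall>i<length xs. snd (xs ! i) \<longrightarrow> (\<forall>j<i. fst (xs ! j) \<noteq> fst (xs ! i)))}"

definition mex :: "(nat \<times> bool) list \<Rightarrow> nat" where
  "mex xs = (LEAST m. m > 0 \<and> m \<notin> fst ` set xs)"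

definition mex_o :: "(nat \<times> bool) list \<Rightarrow> nat" where
  "mex_o xs = (if odd (mex xs) then mex xs else 0)"

definition sigma_o_mex :: "nat \<Rightarrow> nat" where
  "sigma_o_mex n = (\<Sum>xs\<in>overpartitions n. mex_o xs)"

definition qpoch_inf :: "'a \<Rightarrow> 'a \<Rightarrow> 'a :: {t2_space, comm_ring_1}" where
  "qpoch_inf a q = (\<Prod>i. 1 - a * q ^ i)"

text \<open>
  The sum, infinite product and infinite series used with these notions are genuine ones: the set
  of overpartitions of \<open>n\<close> is finite, and the product and the series converge in the metric
  of formal power series.
\<close>

lemma finite_overpartitions: "finite (overpartitions n)"
proof (rule finite_subset)
  show "overpartitions n \<subseteq> {xs. set xs \<subseteq> {..n} \<times> UNIV \<and> length xs \<le> n}"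
  proof
    fix xs assume xs: "xs \<in> overpartitions n"
    have "length ys \<le> sum_list (map fst ys)" if "\<forall>x\<in>set ys. fst x > 0"
      for ys :: "(nat \<times> bool) list"
      using that by (induction ys) auto
    moreover have "fst x \<le> sum_list (map fst xs)" if "x \<in> set xs" for x
      using that by (intro member_le_sum_list) auto
    ultimately show "xs \<in> {xs. set xs \<subseteq> {..n} \<times> UNIV \<and> length xs \<le> n}"
      using xs by (fastforce simp: overpartitions_def)
  qed
  show "finite {xs :: (nat \<times> bool) list. set xs \<subseteq> {..n} \<times> UNIV \<and> length xs \<le> n}"
    by (intro finite_lists_length_le) auto
qed

lemma fps_mult_power_nth_eq_0:
  fixes f q :: "'a::comm_ring_1 fps"
  assumes "fps_nth q 0 = 0" "k < m"
  shows "fps_nth (f * q ^ m) k = 0"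
proof -
  have "fps_nth (q ^ m) i = 0" if "i \<le> k" for i
    using startsby_zero_power_prefix[OF assms(1), of m] that assms(2) by simp
  thus ?thesis by (simp add: fps_mult_nth)
qed

lemma convergent_qpoch_inf_fps:
  fixes a q :: "'a::field fps"
  assumes a: "fps_nth a 0 = 0" and q: "fps_nth q 0 = 0"
  shows "(\<lambda>i. 1 - a * q ^ i) has_prod qpoch_inf a q"
proof -
  define P where "P = (\<lambda>n. \<Prod>i\<le>n. 1 - a * q ^ i)"
  define L where "L = Abs_fps (\<lambda>k. fps_nth (P k) k)"
  have P_Suc: "P (Suc n) = P n - (P n * a) * q ^ Suc n" for n
    by (simp add: P_def algebra_simps)
  have P_stable: "fps_nth (P n) k = fps_nth (P k) k" if "n \<ge> k" for n k
    using that
  proof (induction n rule: dec_induct)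
    case (step n)
    have "fps_nth ((P n * a) * q ^ Suc n) k = 0"
      by (rule fps_mult_power_nth_eq_0) (use step q in auto)
    with step show ?case by (simp only: P_Suc fps_sub_nth) simp
  qed simp
  have "P \<longlonglongrightarrow> L"
  proof (rule tendsto_fpsI)
    show "\<forall>\<^sub>F n in sequentially. fps_nth (P n) k = fps_nth L k" for k
      by (rule eventually_sequentiallyI[of k]) (unfold L_def fps_nth_Abs_fps, rule P_stable)
  qed
  moreover have "fps_nth L 0 = 1"
    using a by (simp add: L_def P_def)
  hence "L \<noteq> 0" by auto
  ultimately have "(\<lambda>i. 1 - a * q ^ i) has_prod L"
    by (simp add: has_prod_def raw_has_prod_def P_def)
  thus ?thesis
    using has_prod_unique unfolding qpoch_inf_def by metis
qed

lemma summable_mex_o_series: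
  "summable (\<lambda>j. of_nat (2 * j + 1) * 4 ^ j * fps_X ^ (j * (2 * j + 1)) *
      (1 - fps_X ^ (2 * j + 1)) * qpoch_inf (- (fps_X ^ (2 * j + 2))) (fps_X :: complex fps))"
proof -
  define f :: "nat \<Rightarrow> complex fps" where "f = (\<lambda>j. of_nat (2 * j + 1) * 4 ^ j * fps_X ^ (j * (2 * j + 1)) *
      (1 - fps_X ^ (2 * j + 1)) * qpoch_inf (- (fps_X ^ (2 * j + 2))) fps_X)"
  have f0: "fps_nth (f j) k = 0" if "j > k" for j k
  proof -
    have "f j = (of_nat (2 * j + 1) * 4 ^ j * (1 - fps_X ^ (2 * j + 1)) *
        qpoch_inf (- (fps_X ^ (2 * j + 2))) fps_X) * fps_X ^ (j * (2 * j + 1))"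
      by (simp only: f_def ac_simps)
    moreover have "k < j * (2 * j + 1)"
      using that by (simp add: trans_less_add1)
    ultimately show ?thesis
      by (metis fps_mult_power_nth_eq_0 fps_X_nth zero_neq_one)
  qed
  have "(\<lambda>n. \<Sum>j<n. f j) \<longlonglongrightarrow> Abs_fps (\<lambda>k. fps_nth (\<Sum>j<Suc k. f j) k)"
  proof (rule tendsto_fpsI)
    fix k
    have "fps_nth (\<Sum>j<n. f j) k = fps_nth (\<Sum>j<Suc k. f j) k" if "n \<ge> Suc k" for n
      unfolding fps_sum_nth
      by (rule sum.mono_neutral_right) (use that f0 in auto)
    thus "\<forall>\<^sub>F n in sequentially. fps_nth (\<Sum>j<n. f j) k =
        fps_nth (Abs_fps (\<lambda>k. fps_nth (\<Sum>j<Suc k. f j) k)) k"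
      by (intro eventually_sequentiallyI[of "Suc k"]) simp
  qed
  thus ?thesis
    unfolding f_def summable_def sums_def by blast
qed

end

theory Submission
  imports Defs
begin

text \<open>
  An overpartition is determined by choosing, for every value \<open>k\<close>, how often \<open>k\<close> occurs and, if it
  occurs at all, whether its first occurrence is overlined. The choices for different values are
  independent, so the generating function of the overpartitions whose multiplicities obey a
  restriction imposed value by value is a product over \<open>k\<close> of one series per value. For the
  condition \<open>mex = m\<close> the factors are \<open>2q\<^sup>k / (1 - q\<^sup>k)\<close> for \<open>k < m\<close> (the value must occur), \<open>1\<close> for
  \<open>k = m\<close> (it must not occur) and \<open>(1 + q\<^sup>k) / (1 - q\<^sup>k)\<close> for \<open>k > m\<close> (no restriction). Multiplying
  by \<open>(q;q)\<^sub>\<infinity>\<close> clears all denominators and leaves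
  \<open>2\<^bsup>m-1\<^esup> q\<^bsup>1+...+(m-1)\<^esup> (1 - q\<^sup>m) (-q\<^bsup>m+1\<^esup>;q)\<^sub>\<infinity>\<close>, which for \<open>m = 2j + 1\<close> is
  \<open>4\<^sup>j q\<^bsup>j(2j+1)\<^esup> (1 - q\<^bsup>2j+1\<^esup>) (-q\<^bsup>2j+2\<^esup>;q)\<^sub>\<infinity>\<close>
  (lemma \<open>fps_card_mex_times_qpoch\<close>). Weighting by the odd value \<open>2j + 1\<close> of the mex and summing
  over \<open>j\<close> gives the identity.

  The product formula is obtained for parts of size at most \<open>N\<close> by splitting off the block of parts
  equal to \<open>N\<close>, which stands at the front of a non-increasing list (lemma
  \<open>bij_betw_split_largest_block\<close>). The infinite product is then a limit in the metric of formal
  power series, where convergence means that every coefficient is eventually constant.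
\<close>

section \<open>Splitting off the largest parts\<close>

abbreviation may_precede :: "nat \<times> bool \<Rightarrow> nat \<times> bool \<Rightarrow> bool" where
  "may_precede x y \<equiv> fst y \<le> fst x \<and> (snd y \<longrightarrow> fst y < fst x)"

text \<open>
  In a non-increasing list, a part may be overlined iff it is strictly smaller than all parts
  before it. In this form the condition is a single pairwise relation, which behaves well under
  concatenation of lists.
\<close>

lemma overpartitions_iff_sorted_wrt:
  "xs \<in> overpartitions n \<longleftrightarrow>
     sorted_wrt may_precede xs \<and>
     (\<forall>x\<in>set xs. fst x > 0) \<and> sum_list (map fst xs) = n"
proof -
  have "sorted_wrt may_precede xs \<longleftrightarrow>
      sorted_wrt (\<lambda>x y. fst y \<le> fst x) xs \<and>
      (\<forall>i<length xs. snd (xs ! i) \<longrightarrow> (\<forall>j<i. fst (xs ! j) \<noteq> fst (xs ! i)))"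
    (is "?L \<longleftrightarrow> ?sorted \<and> ?first")
  proof (intro iffI conjI)
    assume L: ?L
    show ?sorted
      using L by (auto simp: sorted_wrt_iff_nth_less)
    show ?first
      using L by (force simp: sorted_wrt_iff_nth_less)
  next
    assume R: "?sorted \<and> ?first"
    show ?L
      unfolding sorted_wrt_iff_nth_less
    proof (intro allI impI conjI)
      fix j i assume "j < i" "i < length xs"
      thus le: "fst (xs ! i) \<le> fst (xs ! j)"
        using R by (simp add: sorted_wrt_iff_nth_less)
      assume "snd (xs ! i)"
      hence "fst (xs ! j) \<noteq> fst (xs ! i)"
        using R \<open>j < i\<close> \<open>i < length xs\<close> by blast
      thus "fst (xs ! i) < fst (xs ! j)"
        using le by simp
    qed
  qed
  thus ?thesis
    unfolding overpartitions_def sorted_wrt_map mem_Collect_eq by blast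
qed

definition block :: "nat \<Rightarrow> nat \<times> bool \<Rightarrow> (nat \<times> bool) list" where
  "block k = (\<lambda>(c, b). if c = 0 then [] else (k, b) # replicate (c - 1) (k, False))"

text \<open>An empty block has no first part to overline, so it has only one marking.\<close>

definition markings :: "nat \<Rightarrow> bool set" where
  "markings c = (if c = 0 then {False} else UNIV)"

definition restricted_overpartitions ::
    "(nat \<Rightarrow> nat \<Rightarrow> bool) \<Rightarrow> nat \<Rightarrow> nat \<Rightarrow> (nat \<times> bool) list set" where
  "restricted_overpartitions A N n = {xs \<in> overpartitions n.
     (\<forall>x\<in>set xs. fst x \<le> N) \<and> (\<forall>k\<in>{1..N}. A k (count_list (map fst xs) k))}"

lemma finite_restricted_overpartitions: "finite (restricted_overpartitions A N n)"
  by (simp add: restricted_overpartitions_def finite_overpartitions)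

lemma fst_block: "x \<in> set (block k p) \<Longrightarrow> fst x = k"
  by (auto simp: block_def split: prod.splits if_splits)

lemma map_fst_block: "map fst (block k (c, b)) = replicate c k"
  by (cases c) (auto simp: block_def)

lemma sorted_wrt_block: "sorted_wrt may_precede (block k p)"
  by (auto simp: block_def sorted_wrt_iff_nth_less nth_Cons' split: prod.splits)

lemma count_list_replicate: "count_list (replicate c k) k' = (if k' = k then c else 0)"
  by (induction c) auto

text \<open>Only the first of several equal parts may be overlined.\<close>

lemma constant_overpartition_is_block:
  assumes "sorted_wrt may_precede us"
    and k: "\<forall>x\<in>set us. fst x = k"
  obtains c b where "b \<in> markings c" "us = block k (c, b)"
proof (cases us)
  case Nil
  have "False \<in> markings 0" "us = block k (0, False)"
    using Nil by (auto simp: markings_def block_def)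
  thus ?thesis using that by blast
next
  case (Cons x vs)
  have "\<forall>y\<in>set vs. y = (k, False)"
    using assms Cons by (force simp: prod_eq_iff)
  hence "vs = replicate (length vs) (k, False)"
    by (metis replicate_length_same)
  hence "us = block k (Suc (length vs), snd x)"
    using Cons k by (auto simp: block_def prod_eq_iff)
  thus ?thesis using that[of "snd x" "Suc (length vs)"] by (auto simp: markings_def)
qed

lemma sorted_overpartition_split_max:
  assumes "sorted_wrt may_precede xs"
    and "\<forall>x\<in>set xs. fst x \<le> (k :: nat)"
  shows "xs = filter (\<lambda>x. fst x = k) xs @ filter (\<lambda>x. fst x \<noteq> k) xs"
  using assms
proof (induction xs)
  case (Cons x xs)
  show ?case
  proof (cases "fst x = k")
    case True
    thus ?thesis using Cons by auto
  next
    case False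
    hence "\<forall>y\<in>set xs. fst y \<noteq> k"
      using Cons.prems by fastforce
    thus ?thesis using False by (auto simp: filter_empty_conv)
  qed
qed simp

text \<open>
  The block of parts \<open>N + 1\<close> and the list of smaller parts can be chosen independently: every part
  of the block may precede every smaller part, overlined or not, and the multiplicity restriction
  for \<open>N + 1\<close> concerns only the block. Both are recovered from the list by filtering.
\<close>

lemma bij_betw_split_largest_block:
  fixes A :: "nat \<Rightarrow> nat \<Rightarrow> bool"
  shows "bij_betw (\<lambda>(c, b, ys). block (Suc N) (c, b) @ ys)
    (SIGMA c:{c. A (Suc N) c \<and> c * Suc N \<le> n}.
       markings c \<times> restricted_overpartitions A N (n - c * Suc N))
    (restricted_overpartitions A (Suc N) n)"
    (is "bij_betw ?f ?S ?T")
proof -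
  have mem_iff: "block (Suc N) (c, b) @ ys \<in> ?T \<longleftrightarrow>
      A (Suc N) c \<and> c * Suc N \<le> n \<and> ys \<in> restricted_overpartitions A N (n - c * Suc N)"
    if small: "\<forall>y\<in>set ys. fst y \<le> N" for c b ys
  proof -
    have "count_list (map fst ys) (Suc N) = 0"
      using small by (auto simp: count_list_0_iff)
    hence mults: "(\<forall>k\<in>{1..Suc N}. A k (count_list (map fst (block (Suc N) (c, b) @ ys)) k)) \<longleftrightarrow>
        A (Suc N) c \<and> (\<forall>k\<in>{1..N}. A k (count_list (map fst ys) k))"
      by (auto simp: map_fst_block count_list_replicate atLeastAtMostSuc_conv)
    have pos: "\<forall>x\<in>set (block (Suc N) (c, b)). fst x = Suc N"
      using fst_block by blast
    have sorted: "sorted_wrt may_precede (block (Suc N) (c, b) @ ys) \<longleftrightarrow>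
        sorted_wrt may_precede ys"
      using small pos by (fastforce simp: sorted_wrt_append sorted_wrt_block)
    have sum: "sum_list (map fst (block (Suc N) (c, b) @ ys)) =
        c * Suc N + sum_list (map fst ys)"
      by (simp add: map_fst_block sum_list_replicate del: mult_Suc_right)
    show ?thesis
      unfolding restricted_overpartitions_def mem_Collect_eq overpartitions_iff_sorted_wrt
        mults sorted sum
      using small pos by (auto simp del: mult_Suc_right)
  qed
  have "inj_on ?f ?S"
  proof (rule inj_onI)
    fix p p' assume mem: "p \<in> ?S" "p' \<in> ?S" and f_eq: "?f p = ?f p'"
    obtain c b ys c' b' ys' where p: "p = (c, b, ys)" "p' = (c', b', ys')"
      by (cases p, cases p')
    have ys: "ys \<in> restricted_overpartitions A N (n - c * Suc N)"
      "ys' \<in> restricted_overpartitions A N (n - c' * Suc N)"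
      and b: "b \<in> markings c" "b' \<in> markings c'"
      and eq: "block (Suc N) (c, b) @ ys = block (Suc N) (c', b') @ ys'"
      using mem f_eq by (auto simp: p)
    have split: "filter (\<lambda>x. fst x = Suc N) (block (Suc N) p @ zs) = block (Suc N) p"
      if "zs \<in> restricted_overpartitions A N i" for p zs i
      using that
      by (auto simp: filter_empty_conv filter_id_conv fst_block restricted_overpartitions_def)
    have blocks: "block (Suc N) (c, b) = block (Suc N) (c', b')"
      using split[OF ys(1)] split[OF ys(2)] eq by metis
    hence "map fst (block (Suc N) (c, b)) = map fst (block (Suc N) (c', b'))"
      by simp
    hence "c = c'"
      unfolding map_fst_block by (metis length_replicate)
    thus "p = p'"
      using blocks eq b by (auto simp: p block_def markings_def split: if_splits)
  qed
  moreover have "?f ` ?S \<subseteq> ?T"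
  proof (rule image_subsetI)
    fix p assume "p \<in> ?S"
    then obtain c b ys where p: "p = (c, b, ys)" and *: "A (Suc N) c" "c * Suc N \<le> n"
      "ys \<in> restricted_overpartitions A N (n - c * Suc N)"
      by auto
    hence "\<forall>y\<in>set ys. fst y \<le> N"
      by (simp add: restricted_overpartitions_def)
    thus "?f p \<in> ?T"
      using mem_iff[of ys c b] * by (simp add: p)
  qed
  moreover have "?T \<subseteq> ?f ` ?S"
  proof
    fix xs assume xs: "xs \<in> ?T"
    define us ys where "us = filter (\<lambda>x. fst x = Suc N) xs"
      and "ys = filter (\<lambda>x. fst x \<noteq> Suc N) xs"
    have sorted: "sorted_wrt may_precede xs"
      and le: "\<forall>x\<in>set xs. fst x \<le> Suc N"
      using xs by (auto simp: restricted_overpartitions_def overpartitions_iff_sorted_wrt)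
    have "xs = us @ ys"
      unfolding us_def ys_def by (rule sorted_overpartition_split_max[OF sorted le])
    moreover obtain c b where cb: "b \<in> markings c" "us = block (Suc N) (c, b)"
    proof (rule constant_overpartition_is_block)
      show "sorted_wrt may_precede us"
        unfolding us_def by (rule sorted_wrt_filter[OF sorted])
      show "\<forall>x\<in>set us. fst x = Suc N"
        by (simp add: us_def)
    qed
    moreover have "\<forall>y\<in>set ys. fst y \<le> N"
      using le by (auto simp: ys_def le_Suc_eq)
    ultimately show "xs \<in> ?f ` ?S"
      using xs mem_iff[of ys c b] by (intro image_eqI[of _ _ "(c, b, ys)"]) simp_all
  qed
  ultimately show ?thesis
    by (auto simp: bij_betw_def)
qed

section \<open>Generating functions\<close>

text \<open>The contribution of the parts equal to \<open>k\<close>: the exponent is the sum of these parts.\<close>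

definition part_series :: "(nat \<Rightarrow> bool) \<Rightarrow> nat \<Rightarrow> 'a :: comm_ring_1 fps" where
  "part_series P k =
     Abs_fps (\<lambda>i. if k dvd i \<and> P (i div k) then of_nat (card (markings (i div k))) else 0)"

lemma fps_restricted_overpartitions_Suc:
  "Abs_fps (\<lambda>n. of_nat (card (restricted_overpartitions A (Suc N) n)) :: 'a :: comm_ring_1) =
   part_series (A (Suc N)) (Suc N) *
     Abs_fps (\<lambda>n. of_nat (card (restricted_overpartitions A N n)))"
proof (rule fps_ext)
  fix n
  let ?k = "Suc N"
  let ?C = "{c. A ?k c \<and> c * ?k \<le> n}"
  have "finite ?C"
    by (rule finite_subset[of _ "{..n}"]) (auto intro: order.trans[rotated])
  have "card (restricted_overpartitions A ?k n) =
      (\<Sum>c\<in>?C. card (markings c) * card (restricted_overpartitions A N (n - c * ?k)))"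
    unfolding bij_betw_same_card[OF bij_betw_split_largest_block, symmetric]
    using \<open>finite ?C\<close>
    by (subst card_SigmaI)
      (auto simp: card_cartesian_product finite_restricted_overpartitions markings_def)
  hence "of_nat (card (restricted_overpartitions A ?k n)) =
      (\<Sum>c\<in>?C. of_nat (card (markings c)) *
         (of_nat (card (restricted_overpartitions A N (n - c * ?k))) :: 'a))"
    by simp
  also have "\<dots> = (\<Sum>i\<in>(\<lambda>c. c * ?k) ` ?C. fps_nth (part_series (A ?k) ?k) i *
      of_nat (card (restricted_overpartitions A N (n - i))))"
    by (subst sum.reindex)
      (auto simp: inj_on_def part_series_def simp del: mult_Suc_right intro!: sum.cong)
  also have "\<dots> = (\<Sum>i=0..n. fps_nth (part_series (A ?k) ?k) i *
      of_nat (card (restricted_overpartitions A N (n - i))))"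
  proof (rule sum.mono_neutral_left)
    show "\<forall>i\<in>{0..n} - (\<lambda>c. c * ?k) ` ?C. fps_nth (part_series (A ?k) ?k) i *
      of_nat (card (restricted_overpartitions A N (n - i))) = (0 :: 'a)"
    proof
      fix i assume i: "i \<in> {0..n} - (\<lambda>c. c * ?k) ` ?C"
      have "\<not> (?k dvd i \<and> A ?k (i div ?k))"
      proof
        assume *: "?k dvd i \<and> A ?k (i div ?k)"
        hence "i = (i div ?k) * ?k"
          by (metis dvd_div_mult_self)
        with * i show False
          by (metis (mono_tags, lifting) DiffE atLeastAtMost_iff imageI mem_Collect_eq)
      qed
      thus "fps_nth (part_series (A ?k) ?k) i *
        of_nat (card (restricted_overpartitions A N (n - i))) = (0 :: 'a)"
        by (auto simp: part_series_def)
    qed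
  qed auto
  finally show "fps_nth (Abs_fps (\<lambda>n. of_nat (card (restricted_overpartitions A ?k n)))) n =
      fps_nth (part_series (A ?k) ?k *
        Abs_fps (\<lambda>n. of_nat (card (restricted_overpartitions A N n)) :: 'a)) n"
    by (simp add: fps_mult_nth)
qed

lemma fps_restricted_overpartitions:
  "Abs_fps (\<lambda>n. of_nat (card (restricted_overpartitions A N n)) :: 'a :: comm_ring_1) =
   (\<Prod>k=1..N. part_series (A k) k)"
proof (induction N)
  case 0
  have "xs \<in> restricted_overpartitions A 0 n \<longleftrightarrow> xs = [] \<and> n = 0" for xs n
  proof
    assume xs: "xs \<in> restricted_overpartitions A 0 n"
    hence "\<forall>x\<in>set xs. fst x > 0 \<and> fst x \<le> 0" and sum: "sum_list (map fst xs) = n"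
      unfolding restricted_overpartitions_def overpartitions_def by blast+
    hence "xs = []"
      by (cases xs) auto
    thus "xs = [] \<and> n = 0"
      using sum by simp
  qed (simp add: restricted_overpartitions_def overpartitions_def)
  hence "restricted_overpartitions A 0 n = (if n = 0 then {[]} else {})" for n
    by (simp add: set_eq_iff)
  thus ?case by (simp add: fps_eq_iff)
next
  case (Suc N)
  thus ?case
    by (simp add: fps_restricted_overpartitions_Suc mult.commute)
qed

text \<open>
  When all positive multiplicities are admitted, the coefficients of \<open>part_series\<close> at the positive
  multiples of \<open>k\<close> are all \<open>2\<close>, one for each marking, so multiplication by \<open>1 - q\<^sup>k\<close> telescopes;
  whether the multiplicity \<open>0\<close> is admitted only changes the constant coefficient.
\<close>

lemma part_series_times:
  assumes "k > 0"
  shows "part_series (\<lambda>c. c > 0) k * (1 - fps_X ^ k) = (2 * fps_X ^ k :: 'a :: comm_ring_1 fps)"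
    and "part_series (\<lambda>c. c = 0) k = (1 :: 'a :: comm_ring_1 fps)"
    and "part_series (\<lambda>c. True) k * (1 - fps_X ^ k) = (1 + fps_X ^ k :: 'a :: comm_ring_1 fps)"
proof -
  have mult: "fps_nth (f * (1 - fps_X ^ k)) n =
      fps_nth f n - (if n < k then 0 else fps_nth f (n - k))" for f :: "'a fps" and n
    by (simp add: right_diff_distrib fps_X_power_mult_right_nth)
  have two: "fps_nth (2 * fps_X ^ k :: 'a fps) n = (if n = k then 2 else 0)" for n
    by (simp add: numeral_fps_const fps_X_power_nth)
  have dvd: "\<not> k dvd n" if "n < k" "n > 0" for n
    using that by (auto dest: dvd_imp_le)
  show "part_series (\<lambda>c. c > 0) k * (1 - fps_X ^ k) = (2 * fps_X ^ k :: 'a fps)"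
  proof (rule fps_ext)
    fix n
    show "fps_nth (part_series (\<lambda>c. c > 0) k * (1 - fps_X ^ k)) n =
        fps_nth (2 * fps_X ^ k :: 'a fps) n"
    proof (cases "n < k")
      case True
      thus ?thesis unfolding mult two by (auto simp: part_series_def)
    next
      case False
      then obtain m where n: "n = m + k"
        by (metis le_add_diff_inverse2 not_less)
      show ?thesis unfolding mult two n
        using assms dvd[of m] by (auto simp: part_series_def markings_def div_eq_0_iff)
    qed
  qed
  show "part_series (\<lambda>c. True) k * (1 - fps_X ^ k) = (1 + fps_X ^ k :: 'a fps)"
  proof (rule fps_ext)
    fix n
    show "fps_nth (part_series (\<lambda>c. True) k * (1 - fps_X ^ k)) n =
        fps_nth (1 + fps_X ^ k :: 'a fps) n"
    proof (cases "n < k")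
      case True
      thus ?thesis unfolding mult
        using dvd[of n] by (auto simp: part_series_def markings_def fps_X_power_nth)
    next
      case False
      then obtain m where n: "n = m + k"
        by (metis le_add_diff_inverse2 not_less)
      show ?thesis unfolding mult n
        using assms dvd[of m]
        by (auto simp: part_series_def markings_def div_eq_0_iff fps_X_power_nth)
    qed
  qed
  show "part_series (\<lambda>c. c = 0) k = (1 :: 'a fps)"
    using assms dvd
    by (intro fps_ext) (auto simp: part_series_def markings_def div_eq_0_iff)
qed

section \<open>Overpartitions with a given mex\<close>

definition mex_mult :: "nat \<Rightarrow> nat \<Rightarrow> nat \<Rightarrow> bool" where
  "mex_mult m k = (if k < m then (\<lambda>c. c > 0) else if k = m then (\<lambda>c. c = 0) else (\<lambda>c. True))"

lemma mex_eq_iff: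
  assumes "m > 0"
  shows "mex xs = m \<longleftrightarrow> m \<notin> fst ` set xs \<and> {1..<m} \<subseteq> fst ` set xs"
proof
  let ?P = "\<lambda>m. m > 0 \<and> m \<notin> fst ` set xs"
  have "infinite {m :: nat. m > 0}"
    by (metis infinite_Ioi greaterThan_def)
  hence "\<exists>m. ?P m"
    by (metis (no_types, lifting) finite_imageI finite_set finite_subset mem_Collect_eq subsetI)
  hence "?P (mex xs)"
    unfolding mex_def by (rule LeastI_ex)
  moreover have "\<not> ?P k" if "k < mex xs" for k
    using that unfolding mex_def by (rule not_less_Least)
  ultimately show "m \<notin> fst ` set xs \<and> {1..<m} \<subseteq> fst ` set xs" if "mex xs = m"
    using that by force
next
  assume *: "m \<notin> fst ` set xs \<and> {1..<m} \<subseteq> fst ` set xs"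
  show "mex xs = m"
    unfolding mex_def
  proof (rule Least_equality)
    show "m \<le> k" if k: "k > 0 \<and> k \<notin> fst ` set xs" for k
    proof -
      have "k \<notin> {1..<m}"
        using k * by blast
      thus ?thesis using k by simp
    qed
    show "m > 0 \<and> m \<notin> fst ` set xs"
      using * assms by blast
  qed
qed

lemma part_le: "xs \<in> overpartitions n \<Longrightarrow> x \<in> set xs \<Longrightarrow> fst x \<le> n"
  by (auto simp: overpartitions_def intro!: member_le_sum_list)

text \<open>
  The bound \<open>m \<le> N\<close> ensures that the multiplicity restrictions up to \<open>N\<close> contain all those that
  express \<open>mex = m\<close>, and \<open>n \<le> N\<close> that the bound on the parts excludes no overpartition of \<open>n\<close>.
\<close>

lemma restricted_overpartitions_mex_mult:
  assumes "m > 0" "m \<le> N" "n \<le> N"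
  shows "restricted_overpartitions (mex_mult m) N n = {xs \<in> overpartitions n. mex xs = m}"
proof -
  have "(\<forall>k\<in>{1..N}. mex_mult m k (count_list (map fst xs) k)) \<longleftrightarrow> mex xs = m" for xs
  proof -
    have "mex_mult m k (count_list (map fst xs) k) \<longleftrightarrow>
        (k < m \<longrightarrow> k \<in> fst ` set xs) \<and> (k = m \<longrightarrow> k \<notin> fst ` set xs)" for k
      by (auto simp: mex_mult_def count_list_0_iff simp flip: neq0_conv)
    moreover have "(\<forall>k\<in>{1..N}. (k < m \<longrightarrow> Q k) \<and> (k = m \<longrightarrow> \<not> Q k)) \<longleftrightarrow>
        \<not> Q m \<and> (\<forall>k\<in>{1..<m}. Q k)" for Q
      using assms by auto
    ultimately show ?thesis
      unfolding mex_eq_iff[OF assms(1)] subset_eq by (simp only:)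
  qed
  moreover have "\<forall>x\<in>set xs. fst x \<le> N" if "xs \<in> overpartitions n" for xs
    using part_le[OF that] assms(3) by (meson le_trans)
  ultimately show ?thesis
    by (auto simp: restricted_overpartitions_def)
qed

text \<open>
  The finite form of the product formula for a fixed mex. The bound on the parts is written as
  \<open>m + t\<close>, so that \<open>t\<close> factors belong to values above the mex.
\<close>

lemma prod_part_series_mex_mult:
  fixes m t :: nat
  assumes "m > 0"
  shows "(\<Prod>k=1..m+t. part_series (mex_mult m k) k) * (\<Prod>i<m+t. 1 - fps_X * fps_X ^ i) =
    2 ^ (m - 1) * fps_X ^ (\<Sum>{1..<m}) * (1 - fps_X ^ m) *
      (\<Prod>i<t. 1 - (- (fps_X ^ (m + 1))) * (fps_X :: 'a :: comm_ring_1 fps) ^ i)"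
proof -
  define h :: "nat \<Rightarrow> 'a fps" where "h k = part_series (mex_mult m k) k * (1 - fps_X ^ k)" for k
  have "(\<Prod>i<m+t. 1 - fps_X * fps_X ^ i) = (\<Prod>k=1..m+t. 1 - (fps_X :: 'a fps) ^ k)"
    by (rule prod.reindex_bij_witness[of _ "\<lambda>k. k - 1" Suc]) auto
  hence "(\<Prod>k=1..m+t. part_series (mex_mult m k) k) * (\<Prod>i<m+t. 1 - (fps_X :: 'a fps) * fps_X ^ i) =
      (\<Prod>k=1..m+t. h k)"
    by (simp add: h_def prod.distrib)
  also have "\<dots> = prod h ({1..<m} \<union> insert m {m+1..<m+1+t})"
    using assms by (intro prod.cong) auto
  also have "\<dots> = prod h {1..<m} * prod h (insert m {m+1..<m+1+t})"
    by (rule prod.union_disjoint) auto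
  also have "prod h (insert m {m+1..<m+1+t}) = h m * prod h {m+1..<m+1+t}"
    by (rule prod.insert) auto
  also have "prod h {1..<m} = (\<Prod>k=1..<m. 2 * fps_X ^ k)"
    by (intro prod.cong refl) (auto simp: h_def mex_mult_def part_series_times)
  also have "\<dots> = 2 ^ (m - 1) * fps_X ^ (\<Sum>{1..<m})"
    by (simp add: prod.distrib power_sum)
  also have "h m = 1 - fps_X ^ m"
    using assms by (simp add: h_def mex_mult_def part_series_times)
  also have "prod h {m+1..<m+1+t} = (\<Prod>k=m+1..<m+1+t. 1 + fps_X ^ k)"
    by (intro prod.cong refl) (auto simp: h_def mex_mult_def part_series_times)
  also have "\<dots> = (\<Prod>i<t. 1 - (- (fps_X ^ (m + 1))) * fps_X ^ i)"
    by (rule prod.reindex_bij_witness[of _ "\<lambda>i. m + 1 + i" "\<lambda>k. k - (m + 1)"])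
      (auto simp flip: power_add power_Suc)
  finally show ?thesis by (simp add: mult.assoc)
qed

section \<open>Passage to the limit\<close>

text \<open>Each coefficient of a product depends on finitely many coefficients of the factors.\<close>

lemma tendsto_mult_fps:
  fixes f g :: "'b \<Rightarrow> 'a :: comm_ring_1 fps"
  assumes "(f \<longlongrightarrow> a) F" "(g \<longlongrightarrow> b) F"
  shows "((\<lambda>x. f x * g x) \<longlongrightarrow> a * b) F"
proof (rule tendsto_fpsI)
  fix n
  have "\<forall>\<^sub>F x in F. \<forall>k\<in>{..n}. fps_nth (f x) k = fps_nth a k"
    and "\<forall>\<^sub>F x in F. \<forall>k\<in>{..n}. fps_nth (g x) k = fps_nth b k"
    using assms by (auto simp: tendsto_fps_iff intro!: eventually_ball_finite)
  thus "\<forall>\<^sub>F x in F. fps_nth (f x * g x) n = fps_nth (a * b) n"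
    by eventually_elim (auto simp: fps_mult_nth intro!: sum.cong)
qed

lemma LIMSEQ_qpoch_inf_fps:
  fixes a q :: "'a::field fps"
  assumes "fps_nth a 0 = 0" "fps_nth q 0 = 0"
  shows "(\<lambda>n. \<Prod>i<n. 1 - a * q ^ i) \<longlonglongrightarrow> qpoch_inf a q"
  by (rule has_prod_imp_tendsto'[OF convergent_qpoch_inf_fps[OF assms]])

lemma qpoch_inf_fps_nth_0:
  fixes a q :: "'a::field fps"
  assumes "fps_nth a 0 = 0" "fps_nth q 0 = 0"
  shows "fps_nth (qpoch_inf a q) 0 = 1"
proof -
  have "\<forall>\<^sub>F n in sequentially. fps_nth (\<Prod>i<n. 1 - a * q ^ i) 0 = fps_nth (qpoch_inf a q) 0"
    using LIMSEQ_qpoch_inf_fps[OF assms] unfolding tendsto_fps_iff by blast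
  moreover have "fps_nth (\<Prod>i<n. 1 - a * q ^ i) 0 = 1" for n
    using assms by (induction n) auto
  ultimately show ?thesis by simp
qed

definition fps_card_mex :: "nat \<Rightarrow> 'a :: comm_ring_1 fps" where
  "fps_card_mex m = Abs_fps (\<lambda>n. of_nat (card {xs \<in> overpartitions n. mex xs = m}))"

lemma fps_card_mex_times_qpoch:
  assumes "m > 0"
  shows "fps_card_mex m * qpoch_inf fps_X fps_X =
    2 ^ (m - 1) * fps_X ^ (\<Sum>{1..<m}) * (1 - fps_X ^ m) *
      qpoch_inf (- (fps_X ^ (m + 1))) (fps_X :: 'a :: field fps)"
proof (rule LIMSEQ_unique)
  let ?F = "\<lambda>t. \<Prod>k=1..m+t. part_series (mex_mult m k) k :: 'a fps"
  let ?Q = "\<lambda>t. \<Prod>i<m+t. 1 - fps_X * (fps_X :: 'a fps) ^ i"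
  have "?F \<longlonglongrightarrow> fps_card_mex m"
  proof (rule tendsto_fpsI)
    fix n
    have "fps_nth (?F t) n = fps_nth (fps_card_mex m) n" if "t \<ge> n" for t
      using that assms
      unfolding fps_restricted_overpartitions[symmetric]
      by (simp add: restricted_overpartitions_mex_mult fps_card_mex_def)
    thus "\<forall>\<^sub>F t in sequentially. fps_nth (?F t) n = fps_nth (fps_card_mex m) n"
      by (intro eventually_sequentiallyI[of n])
  qed
  moreover have "?Q \<longlonglongrightarrow> qpoch_inf fps_X fps_X"
    using LIMSEQ_ignore_initial_segment[OF LIMSEQ_qpoch_inf_fps, of "fps_X :: 'a fps" fps_X m]
    by (simp add: add.commute)
  ultimately show "(\<lambda>t. ?F t * ?Q t) \<longlonglongrightarrow> fps_card_mex m * qpoch_inf fps_X fps_X"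
    by (rule tendsto_mult_fps)
  show "(\<lambda>t. ?F t * ?Q t) \<longlonglongrightarrow> 2 ^ (m - 1) * fps_X ^ (\<Sum>{1..<m}) * (1 - fps_X ^ m) *
      qpoch_inf (- (fps_X ^ (m + 1))) fps_X"
    unfolding prod_part_series_mex_mult[OF assms]
    by (intro tendsto_mult_fps tendsto_const LIMSEQ_qpoch_inf_fps) auto
qed

lemma mex_le:
  assumes "xs \<in> overpartitions n"
  shows "mex xs \<le> n + 1"
proof -
  have "n + 1 \<notin> fst ` set xs"
    using part_le[OF assms] by fastforce
  thus ?thesis
    unfolding mex_def by (intro Least_le) auto
qed

text \<open>
  Grouping by the value of the mex. As the mex is at most \<open>n + 1\<close>, all terms with \<open>2 * j > n\<close>
  vanish, and any cut-off \<open>N > n\<close> gives the same sum.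
\<close>

lemma sigma_o_mex_eq_sum:
  assumes "n < N"
  shows "sigma_o_mex n = (\<Sum>j<N. (2 * j + 1) * card {xs \<in> overpartitions n. mex xs = 2 * j + 1})"
proof -
  have "mex_o xs = (\<Sum>j<N. if mex xs = 2 * j + 1 then 2 * j + 1 else 0)"
    if "xs \<in> overpartitions n" for xs
  proof (cases "odd (mex xs)")
    case True
    then obtain i where i: "mex xs = 2 * i + 1"
      by (elim oddE)
    moreover have "i < N"
      using mex_le[OF that] i assms by simp
    moreover have "(\<Sum>j<N. if 2 * i + 1 = 2 * j + 1 then 2 * j + 1 else 0) =
        (\<Sum>j<N. if j = i then 2 * j + 1 else 0)"
      by (intro sum.cong) auto
    ultimately show ?thesis
      by (simp add: mex_o_def)
  qed (auto simp: mex_o_def intro!: sum.neutral[symmetric])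
  hence "sigma_o_mex n =
      (\<Sum>xs\<in>overpartitions n. \<Sum>j<N. if mex xs = 2 * j + 1 then 2 * j + 1 else 0)"
    by (simp add: sigma_o_mex_def)
  also have "\<dots> = (\<Sum>j<N. \<Sum>xs\<in>overpartitions n. if mex xs = 2 * j + 1 then 2 * j + 1 else 0)"
    by (rule sum.swap)
  also have "\<dots> = (\<Sum>j<N. (2 * j + 1) * card {xs \<in> overpartitions n. mex xs = 2 * j + 1})"
    by (intro sum.cong refl)
      (simp add: sum.If_cases finite_overpartitions Int_def mult.commute)
  finally show ?thesis .
qed

lemma sums_fps_card_mex:
  "(\<lambda>j. of_nat (2 * j + 1) * fps_card_mex (2 * j + 1)) sums
     (Abs_fps (\<lambda>n. of_nat (sigma_o_mex n)) :: 'a :: comm_ring_1 fps)"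
  unfolding sums_def
proof (rule tendsto_fpsI)
  fix n
  have "fps_nth (\<Sum>j<N. of_nat (2 * j + 1) * fps_card_mex (2 * j + 1)) n =
      (of_nat (sigma_o_mex n) :: 'a)" if "N \<ge> Suc n" for N
  proof -
    have "fps_nth (\<Sum>j<N. of_nat (2 * j + 1) * fps_card_mex (2 * j + 1)) n =
        (\<Sum>j<N. of_nat ((2 * j + 1) * card {xs \<in> overpartitions n. mex xs = 2 * j + 1}) :: 'a)"
      unfolding fps_sum_nth fps_of_nat[symmetric] fps_mult_left_const_nth fps_card_mex_def
      by (simp add: algebra_simps)
    also have "\<dots> = of_nat (sigma_o_mex n)"
      using that by (subst sigma_o_mex_eq_sum[of n N]) simp_all
    finally show ?thesis .
  qed
  thus "\<forall>\<^sub>F N in sequentially.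
      fps_nth (\<Sum>j<N. of_nat (2 * j + 1) * fps_card_mex (2 * j + 1)) n =
      fps_nth (Abs_fps (\<lambda>n. of_nat (sigma_o_mex n) :: 'a)) n"
    by (intro eventually_sequentiallyI[of "Suc n"]) simp
qed

theorem theorem1p1:
  shows "Abs_fps (\<lambda>n. of_nat (sigma_o_mex n)) =
    1 / qpoch_inf fps_X fps_X *
    (\<Sum>j. of_nat (2 * j + 1) * 4 ^ j * fps_X ^ (j * (2 * j + 1)) *
      (1 - fps_X ^ (2 * j + 1)) * qpoch_inf (- (fps_X ^ (2 * j + 2))) (fps_X :: complex fps))"
proof -
  let ?Q = "qpoch_inf fps_X fps_X :: complex fps"
  let ?S = "Abs_fps (\<lambda>n. of_nat (sigma_o_mex n)) :: complex fps"
  let ?f = "\<lambda>j. of_nat (2 * j + 1) * 4 ^ j * fps_X ^ (j * (2 * j + 1)) *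
      (1 - fps_X ^ (2 * j + 1)) * qpoch_inf (- (fps_X ^ (2 * j + 2))) (fps_X :: complex fps)"
  have f: "of_nat (2 * j + 1) * fps_card_mex (2 * j + 1) * ?Q = ?f j" for j
  proof -
    have "\<Sum>{1..<2 * j + 1} = j * (2 * j + 1)"
      by (induction j) (auto simp: algebra_simps)
    moreover have "(2 :: complex fps) ^ (2 * j) = 4 ^ j"
      by (simp add: power_mult)
    ultimately show ?thesis
      using fps_card_mex_times_qpoch[of "2 * j + 1", where 'a = complex]
      by (simp add: mult.assoc)
  qed
  have "(\<lambda>N. (\<Sum>j<N. of_nat (2 * j + 1) * fps_card_mex (2 * j + 1)) * ?Q) \<longlonglongrightarrow> ?S * ?Q"
    using sums_fps_card_mex unfolding sums_def by (rule tendsto_mult_fps) (rule tendsto_const)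
  hence "?f sums (?S * ?Q)"
    unfolding sums_def sum_distrib_right f .
  hence "(\<Sum>j. ?f j) = ?S * ?Q"
    by (rule sums_unique[symmetric])
  moreover have "1 / ?Q * (?S * ?Q) = ?S"
  proof -
    have "fps_nth ?Q 0 \<noteq> 0"
      by (simp add: qpoch_inf_fps_nth_0)
    hence "inverse ?Q * ?Q = 1" and "1 / ?Q = inverse ?Q"
      by (simp_all add: inverse_mult_eq_1 fps_divide_unit)
    thus ?thesis
      by (metis mult.assoc mult.commute mult.right_neutral)
  qed
  ultimately show ?thesis by simp
qed

end
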